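(* Let $(X,\mathcal{T}_1,\mathcal{T}_2,E)$ be a bi-soft topological space over $X$ and let $Y$ be a non-empty subset of $X$. If $(X,\mathcal{T}_1,\mathcal{T}_2,E)$ is a pair-wise soft $T_1$-space, then $(Y,\mathcal{T}_{1Y},\mathcal{T}_{2Y},E)$ is also a pair-wise soft $T_1$-space.
   Context: $X$ is a set (initial universe) and $E$ is a non-empty set of parameters. A soft set $(F,E)$ over $X$ is a map $F:E\to\mathcal{P}(X)$, where $\mathcal{P}(X)$ is the power set of $X$. Unions and intersections of soft sets are taken parameterwise. $\Phi$ denotes the soft set with value $\emptyset$ at every $e\in E$ and $\widetilde{X}$ the soft set with value $X$ at every $e\in E$. For $x\in X$, $x\in(F,E)$ means $x\in F(e)$ for all $e\in E$ (so $x\notin(F,E)$ means $x\notin F(e)$ for some $e\in E$). A soft topology on $X$ is a collection $\mathcal{T}$ of soft sets over $X$ (with parameter set $E$) containing $\Phi$ and $\widetilde{X}$ and closed under arbitrary unions and under intersections of two members; its members are called soft open. A bi-soft topological space $(X,\mathcal{T}_1,\mathcal{T}_2,E)$ consists of two soft topologies $\mathcal{T}_1,\mathcal{T}_2$ on $X$ with the same parameter set $E$. For a non-empty $Y\subseteq X$ and a soft set $(F,E)$ over $X$, $({}^YF,E)$ is the soft set with ${}^YF(e)=Y\cap F(e)$ for all $e\in E$. The soft relative topology is $\mathcal{T}_{iY}=\{({}^YF,E)\mid(F,E)\in\mathcal{T}_i\}$, a soft topology on $Y$, and $(Y,\mathcal{T}_{1Y},\mathcal{T}_{2Y},E)$ is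 the corresponding bi-soft topological space over $Y$. $(X,\mathcal{T}_1,\mathcal{T}_2,E)$ is a pair-wise soft $T_1$-space if for all $x,y\in X$ with $x\neq y$ there are $(F,E)\in\mathcal{T}_1$ with $x\in(F,E)$, $y\notin(F,E)$ and $(G,E)\in\mathcal{T}_2$ with $x\notin(G,E)$, $y\in(G,E)$. *)

theory Defs
  imports "HOL-Library.FuncSet"
begin

text \<open>
  A soft set over \<open>X\<close> with parameters in \<open>E\<close> is a map from \<open>E\<close> to the power set of \<open>X\<close>.  It is
  represented by an extensional function (undefined off \<open>E\<close>), so that HOL equality of such
  functions is equality of soft sets.
\<close>

definition soft_sets :: "'e set \<Rightarrow> 'a set \<Rightarrow> ('e \<Rightarrow> 'a set) set" where
  "soft_sets E X = E \<rightarrow>\<^sub>E Pow X"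

definition soft_null :: "'e set \<Rightarrow> 'e \<Rightarrow> 'a set" where
  "soft_null E = (\<lambda>e\<in>E. {})"

definition soft_absolute :: "'e set \<Rightarrow> 'a set \<Rightarrow> 'e \<Rightarrow> 'a set" where
  "soft_absolute E X = (\<lambda>e\<in>E. X)"

definition soft_Union :: "'e set \<Rightarrow> ('e \<Rightarrow> 'a set) set \<Rightarrow> 'e \<Rightarrow> 'a set" where
  "soft_Union E \<F> = (\<lambda>e\<in>E. \<Union>F\<in>\<F>. F e)"

definition soft_inter :: "'e set \<Rightarrow> ('e \<Rightarrow> 'a set) \<Rightarrow> ('e \<Rightarrow> 'a set) \<Rightarrow> 'e \<Rightarrow> 'a set" where
  "soft_inter E F G = (\<lambda>e\<in>E. F e \<inter> G e)"

definition soft_mem :: "'e set \<Rightarrow> 'a \<Rightarrow> ('e \<Rightarrow> 'a set) \<Rightarrow> bool" where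
  "soft_mem E x F \<longleftrightarrow> (\<forall>e\<in>E. x \<in> F e)"

definition soft_topology :: "'a set \<Rightarrow> 'e set \<Rightarrow> ('e \<Rightarrow> 'a set) set \<Rightarrow> bool" where
  "soft_topology X E \<T> \<longleftrightarrow>
     \<T> \<subseteq> soft_sets E X \<and>
     soft_null E \<in> \<T> \<and>
     soft_absolute E X \<in> \<T> \<and>
     (\<forall>\<F>. \<F> \<subseteq> \<T> \<longrightarrow> soft_Union E \<F> \<in> \<T>) \<and>
     (\<forall>F\<in>\<T>. \<forall>G\<in>\<T>. soft_inter E F G \<in> \<T>)"

definition bi_soft_topological_space ::
    "'a set \<Rightarrow> ('e \<Rightarrow> 'a set) set \<Rightarrow> ('e \<Rightarrow> 'a set) set \<Rightarrow> 'e set \<Rightarrow> bool" where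
  "bi_soft_topological_space X \<T>1 \<T>2 E \<longleftrightarrow>
     E \<noteq> {} \<and> soft_topology X E \<T>1 \<and> soft_topology X E \<T>2"

definition soft_restrict :: "'e set \<Rightarrow> 'a set \<Rightarrow> ('e \<Rightarrow> 'a set) \<Rightarrow> 'e \<Rightarrow> 'a set" where
  "soft_restrict E Y F = (\<lambda>e\<in>E. Y \<inter> F e)"

definition soft_relative_topology ::
    "'e set \<Rightarrow> 'a set \<Rightarrow> ('e \<Rightarrow> 'a set) set \<Rightarrow> ('e \<Rightarrow> 'a set) set" where
  "soft_relative_topology E Y \<T> = {soft_restrict E Y F | F. F \<in> \<T>}"

definition pairwise_soft_T1_space ::
    "'a set \<Rightarrow> ('e \<Rightarrow> 'a set) set \<Rightarrow> ('e \<Rightarrow> 'a set) set \<Rightarrow> 'e set \<Rightarrow> bool" where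
  "pairwise_soft_T1_space X \<T>1 \<T>2 E \<longleftrightarrow>
     bi_soft_topological_space X \<T>1 \<T>2 E \<and>
     (\<forall>x\<in>X. \<forall>y\<in>X. x \<noteq> y \<longrightarrow>
        (\<exists>F\<in>\<T>1. soft_mem E x F \<and> \<not> soft_mem E y F) \<and>
        (\<exists>G\<in>\<T>2. \<not> soft_mem E x G \<and> soft_mem E y G))"

end

theory Submission
  imports Defs
begin

text \<open>
  Restriction to \<open>Y\<close> is parameterwise intersection with \<open>Y\<close>.  It therefore commutes with arbitrary
  unions and with binary intersections and sends \<open>X\<close> to \<open>Y\<close>, which makes the restricted soft sets
  a soft topology on \<open>Y\<close> (\<open>soft_topology_relative\<close>).  It also leaves membership of a point of \<open>Y\<close>
  unchanged at every single parameter (\<open>soft_mem_restrict\<close>), so both \<open>x \<in> (F,E)\<close> and its negation,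
  which only speaks of some parameter, survive restriction.  Hence soft open sets that separate two
  points of \<open>Y\<close> in \<open>X\<close> restrict to soft open sets that separate them in \<open>Y\<close>.
\<close>

lemma soft_mem_restrict:
  assumes "x \<in> Y"
  shows "soft_mem E x (soft_restrict E Y F) \<longleftrightarrow> soft_mem E x F"
  using assms by (simp add: soft_mem_def soft_restrict_def)

lemma soft_restrict_in_soft_sets: "soft_restrict E Y F \<in> soft_sets E Y"
  by (auto simp: soft_restrict_def soft_sets_def)

lemma soft_restrict_null: "soft_restrict E Y (soft_null E) = soft_null E"
  by (auto simp: soft_restrict_def soft_null_def intro!: restrict_ext)

lemma soft_restrict_absolute:
  assumes "Y \<subseteq> X"
  shows "soft_restrict E Y (soft_absolute E X) = soft_absolute E Y"
  using assms by (auto simp: soft_restrict_def soft_absolute_def intro!: restrict_ext)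

lemma soft_restrict_Union:
  "soft_restrict E Y (soft_Union E \<F>) = soft_Union E (soft_restrict E Y ` \<F>)"
  by (auto simp: soft_restrict_def soft_Union_def intro!: restrict_ext)

lemma soft_restrict_inter:
  "soft_restrict E Y (soft_inter E F G) =
     soft_inter E (soft_restrict E Y F) (soft_restrict E Y G)"
  by (auto simp: soft_restrict_def soft_inter_def intro!: restrict_ext)

lemma soft_relative_topology_eq_image:
  "soft_relative_topology E Y \<T> = soft_restrict E Y ` \<T>"
  by (auto simp: soft_relative_topology_def)

lemma soft_topology_relative:
  assumes top: "soft_topology X E \<T>" and "Y \<subseteq> X"
  shows "soft_topology Y E (soft_relative_topology E Y \<T>)"
  unfolding soft_topology_def soft_relative_topology_eq_image
proof (intro conjI allI impI ballI)
  show "soft_restrict E Y ` \<T> \<subseteq> soft_sets E Y"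
    by (auto intro: soft_restrict_in_soft_sets)
next
  have "soft_null E \<in> \<T>"
    using top by (simp add: soft_topology_def)
  then show "soft_null E \<in> soft_restrict E Y ` \<T>"
    by (metis imageI soft_restrict_null)
next
  have "soft_absolute E X \<in> \<T>"
    using top by (simp add: soft_topology_def)
  then show "soft_absolute E Y \<in> soft_restrict E Y ` \<T>"
    by (metis imageI soft_restrict_absolute[OF \<open>Y \<subseteq> X\<close>])
next
  fix \<F> assume "\<F> \<subseteq> soft_restrict E Y ` \<T>"
  then obtain \<G> where \<G>: "\<G> \<subseteq> \<T>" "\<F> = soft_restrict E Y ` \<G>"
    by (auto simp: subset_image_iff)
  have "soft_Union E \<G> \<in> \<T>"
    using top \<G>(1) by (simp add: soft_topology_def)
  then show "soft_Union E \<F> \<in> soft_restrict E Y ` \<T>"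
    unfolding \<G>(2) soft_restrict_Union[symmetric] by (rule imageI)
next
  fix F G assume "F \<in> soft_restrict E Y ` \<T>" "G \<in> soft_restrict E Y ` \<T>"
  then obtain F' G' where FG: "F' \<in> \<T>" "G' \<in> \<T>"
      "F = soft_restrict E Y F'" "G = soft_restrict E Y G'"
    by auto
  have "soft_inter E F' G' \<in> \<T>"
    using top FG(1,2) by (simp add: soft_topology_def)
  then show "soft_inter E F G \<in> soft_restrict E Y ` \<T>"
    unfolding FG(3,4) soft_restrict_inter[symmetric] by (rule imageI)
qed

theorem proposition10:
  fixes X Y :: "'a set" and E :: "'e set" and \<T>1 \<T>2 :: "('e \<Rightarrow> 'a set) set"
  assumes "bi_soft_topological_space X \<T>1 \<T>2 E"
    and "Y \<noteq> {}" and "Y \<subseteq> X"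
    and "pairwise_soft_T1_space X \<T>1 \<T>2 E"
  shows "pairwise_soft_T1_space Y (soft_relative_topology E Y \<T>1) (soft_relative_topology E Y \<T>2) E"
  unfolding pairwise_soft_T1_space_def
proof (intro conjI ballI impI)
  show "bi_soft_topological_space Y (soft_relative_topology E Y \<T>1) (soft_relative_topology E Y \<T>2) E"
    using assms(1,3) unfolding bi_soft_topological_space_def by (blast intro: soft_topology_relative)
next
  fix x y assume xy: "x \<in> Y" "y \<in> Y" "x \<noteq> y"
  then obtain F where "F \<in> \<T>1" "soft_mem E x F" "\<not> soft_mem E y F"
    using assms(3,4) unfolding pairwise_soft_T1_space_def by blast
  then show "\<exists>F\<in>soft_relative_topology E Y \<T>1. soft_mem E x F \<and> \<not> soft_mem E y F"
    using xy by (auto simp: soft_relative_topology_eq_image soft_mem_restrict)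
next
  fix x y assume xy: "x \<in> Y" "y \<in> Y" "x \<noteq> y"
  then obtain G where "G \<in> \<T>2" "\<not> soft_mem E x G" "soft_mem E y G"
    using assms(3,4) unfolding pairwise_soft_T1_space_def by blast
  then show "\<exists>G\<in>soft_relative_topology E Y \<T>2. \<not> soft_mem E x G \<and> soft_mem E y G"
    using xy by (auto simp: soft_relative_topology_eq_image soft_mem_restrict)
qed

end
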